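(* Let $ABC$ be a non-degenerate triangle of the hyperbolic plane (curvature $-1$) with side lengths $a,b,c$, having a circumscribed circle with centre $O$ and radius $R$, and let $I$ and $r$ be the centre and radius of its inscribed circle. Then $$\cosh OI=2\cosh\frac a2\cosh\frac b2\cosh\frac c2\cosh r\cosh R-\cosh\frac{a+b+c}{2}\cosh(R-r).$$
   Context: $OI$ denotes the hyperbolic distance between the points $O$ and $I$. *)

theory Defs
  imports "HOL-Analysis.Analysis"
begin

(* The hyperbolic plane of curvature -1 in the hyperboloid model: the upper sheet of
   lorentz x x = -1 in Minkowski 3-space, where lorentz has signature (+,+,-). *)

definition lorentz :: "real ^ 3 \<Rightarrow> real ^ 3 \<Rightarrow> real" where
  "lorentz x y = x $ 1 * y $ 1 + x $ 2 * y $ 2 - x $ 3 * y $ 3"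

typedef hyp_plane = "{x :: real ^ 3. lorentz x x = - 1 \<and> x $ 3 > 0}"
  morphisms hvec Abs_hyp_plane
proof
  show "vector [0, 0, 1] \<in> {x :: real ^ 3. lorentz x x = - 1 \<and> x $ 3 > 0}"
    by (simp add: lorentz_def)
qed

lemma lorentz_commute: "lorentz x y = lorentz y x"
  by (simp add: lorentz_def mult.commute)

lemma lorentz_hvec_self: "lorentz (hvec P) (hvec P) = - 1"
  using hvec[of P] by simp

lemma hvec_3_pos: "hvec P $ 3 > 0"
  using hvec[of P] by simp

lemma hvec_3_eq: "(hvec P $ 3)\<^sup>2 = 1 + (hvec P $ 1)\<^sup>2 + (hvec P $ 2)\<^sup>2"
  using lorentz_hvec_self[of P] by (simp add: lorentz_def power2_eq_square)

lemma lorentz_hvec_le: "lorentz (hvec P) (hvec Q) \<le> - 1"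
proof -
  define a b c where "a = hvec P $ 1" and "b = hvec P $ 2" and "c = hvec P $ 3"
  define d e f where "d = hvec Q $ 1" and "e = hvec Q $ 2" and "f = hvec Q $ 3"
  have c: "c\<^sup>2 = 1 + a\<^sup>2 + b\<^sup>2" "c > 0" and f: "f\<^sup>2 = 1 + d\<^sup>2 + e\<^sup>2" "f > 0"
    using hvec_3_eq[of P] hvec_3_eq[of Q] hvec_3_pos[of P] hvec_3_pos[of Q]
    by (simp_all add: a_def b_def c_def d_def e_def f_def)
  have "(c * f)\<^sup>2 - (1 + a * d + b * e)\<^sup>2 = (a - d)\<^sup>2 + (b - e)\<^sup>2 + (a * e - b * d)\<^sup>2"
    unfolding power_mult_distrib c f by (simp add: power2_eq_square algebra_simps)
  then have "(1 + a * d + b * e)\<^sup>2 \<le> (c * f)\<^sup>2"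
    by (smt (verit) zero_le_power2)
  then have "1 + a * d + b * e \<le> c * f"
    by (rule power2_le_imp_le) (use c f in simp)
  then show ?thesis
    by (simp add: lorentz_def a_def b_def c_def d_def e_def f_def)
qed

lemma lorentz_hvec_eq_iff: "lorentz (hvec P) (hvec Q) = - 1 \<longleftrightarrow> P = Q"
proof
  assume *: "lorentz (hvec P) (hvec Q) = - 1"
  define a b c where "a = hvec P $ 1" and "b = hvec P $ 2" and "c = hvec P $ 3"
  define d e f where "d = hvec Q $ 1" and "e = hvec Q $ 2" and "f = hvec Q $ 3"
  have c: "c\<^sup>2 = 1 + a\<^sup>2 + b\<^sup>2" "c > 0" and f: "f\<^sup>2 = 1 + d\<^sup>2 + e\<^sup>2" "f > 0"
    using hvec_3_eq[of P] hvec_3_eq[of Q] hvec_3_pos[of P] hvec_3_pos[of Q]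
    by (simp_all add: a_def b_def c_def d_def e_def f_def)
  have "c * f = 1 + a * d + b * e"
    using * by (simp add: lorentz_def a_def b_def c_def d_def e_def f_def)
  moreover have "(c * f)\<^sup>2 - (1 + a * d + b * e)\<^sup>2
      = (a - d)\<^sup>2 + (b - e)\<^sup>2 + (a * e - b * d)\<^sup>2"
    unfolding power_mult_distrib c f by (simp add: power2_eq_square algebra_simps)
  ultimately have "(a - d)\<^sup>2 + (b - e)\<^sup>2 + (a * e - b * d)\<^sup>2 = 0"
    by simp
  then have "(a - d)\<^sup>2 = 0 \<and> (b - e)\<^sup>2 = 0"
    by (smt (verit) zero_le_power2)
  then have ad: "a = d" "b = e"
    by simp_all
  then have "c = f"
    using c f by (metis less_imp_le power2_eq_iff_nonneg)
  with ad have "hvec P = hvec Q"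
    by (simp add: vec_eq_iff forall_3 a_def b_def c_def d_def e_def f_def)
  then show "P = Q"
    by (simp add: hvec_inject)
qed (simp add: lorentz_hvec_self)

lemma lorentz_gram:
  assumes "lorentz x x = - 1" "lorentz y y = - 1" "lorentz z z = - 1"
  shows "(lorentz x z + lorentz x y * lorentz y z)\<^sup>2
    \<le> ((lorentz x y)\<^sup>2 - 1) * ((lorentz y z)\<^sup>2 - 1)"
proof -
  have *: "2 * lorentz x y * lorentz y z * lorentz x z
      + lorentz x x * lorentz y y * lorentz z z
      - lorentz x x * (lorentz y z)\<^sup>2 - lorentz y y * (lorentz x z)\<^sup>2
      - lorentz z z * (lorentz x y)\<^sup>2
    = - (x $ 1 * (y $ 2 * z $ 3 - y $ 3 * z $ 2) - x $ 2 * (y $ 1 * z $ 3 - y $ 3 * z $ 1)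
      + x $ 3 * (y $ 1 * z $ 2 - y $ 2 * z $ 1))\<^sup>2"
    unfolding lorentz_def by algebra
  have "2 * lorentz x y * lorentz y z * lorentz x z - 1
      + (lorentz y z)\<^sup>2 + (lorentz x z)\<^sup>2 + (lorentz x y)\<^sup>2 \<le> 0"
    using * by (simp add: assms)
  then show ?thesis
    by (simp add: power2_eq_square algebra_simps)
qed

instantiation hyp_plane :: metric_space
begin

definition dist_hyp_plane :: "hyp_plane \<Rightarrow> hyp_plane \<Rightarrow> real" where
  "dist P Q = arcosh (- lorentz (hvec P) (hvec Q))"

definition uniformity_hyp_plane_def:
  "(uniformity :: (hyp_plane \<times> hyp_plane) filter) = (INF e\<in>{0 <..}. principal {(P, Q). dist P Q < e})"

definition open_hyp_plane_def:
  "open (U :: hyp_plane set) \<longleftrightarrow> (\<forall>P\<in>U. \<forall>\<^sub>F (P', Q) in uniformity. P' = P \<longrightarrow> Q \<in> U)"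

lemma cosh_dist_aux: "cosh (dist P Q) = - lorentz (hvec P) (hvec Q)" for P Q :: hyp_plane
  using lorentz_hvec_le[of P Q] by (simp add: dist_hyp_plane_def)

lemma dist_nonneg_aux: "dist P Q \<ge> 0" for P Q :: hyp_plane
  using lorentz_hvec_le[of P Q] by (simp add: dist_hyp_plane_def)

instance
proof
  fix P Q S :: hyp_plane
  show "dist P Q = 0 \<longleftrightarrow> P = Q"
    using cosh_dist_aux[of P Q] lorentz_hvec_eq_iff[of P Q] lorentz_hvec_le[of P Q]
    by (auto simp: dist_hyp_plane_def lorentz_hvec_self)
  define p q where "p = dist P S" and "q = dist Q S"
  have pq: "p \<ge> 0" "q \<ge> 0"
    by (simp_all add: p_def q_def dist_nonneg_aux)
  have cp: "lorentz (hvec P) (hvec S) = - cosh p"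
    and cq: "lorentz (hvec S) (hvec Q) = - cosh q"
    by (simp_all add: p_def q_def cosh_dist_aux lorentz_commute[of "hvec S"])
  have "(lorentz (hvec P) (hvec Q) + cosh p * cosh q)\<^sup>2
      \<le> ((cosh p)\<^sup>2 - 1) * ((cosh q)\<^sup>2 - 1)"
    using lorentz_gram[of "hvec P" "hvec S" "hvec Q"]
    by (simp add: lorentz_hvec_self cp cq)
  also have "\<dots> = (sinh p * sinh q)\<^sup>2"
    by (simp add: cosh_square_eq power_mult_distrib)
  finally have "\<bar>lorentz (hvec P) (hvec Q) + cosh p * cosh q\<bar> \<le> \<bar>sinh p * sinh q\<bar>"
    by (simp only: abs_le_square_iff)
  moreover have "sinh p * sinh q \<ge> 0"
    using pq by simp
  ultimately have "cosh (dist P Q) \<le> cosh (p + q)"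
    unfolding cosh_dist_aux cosh_add by linarith
  then have "dist P Q \<le> p + q"
    using pq by (simp add: cosh_real_nonneg_le_iff dist_nonneg_aux)
  then show "dist P Q \<le> dist P S + dist Q S"
    by (simp add: p_def q_def)
qed (simp_all only: uniformity_hyp_plane_def open_hyp_plane_def)

end

lemma cosh_dist_hyp_plane: "cosh (dist P Q) = - lorentz (hvec P) (hvec Q)"
  for P Q :: hyp_plane
  by (rule cosh_dist_aux)

(* Geodesic lines are the sections of the hyperboloid by planes through the origin;
   for P = Q the set below is just {P}. *)

definition hyp_line :: "hyp_plane \<Rightarrow> hyp_plane \<Rightarrow> hyp_plane set" where
  "hyp_line P Q = {X. hvec X \<in> span {hvec P, hvec Q}}"

(* The radial projection of the Euclidean segment between hvec P and hvec Q. *)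

definition hyp_segment :: "hyp_plane \<Rightarrow> hyp_plane \<Rightarrow> hyp_plane set" where
  "hyp_segment P Q = {X. \<exists>s\<ge>0. \<exists>t\<ge>0. hvec X = s *\<^sub>R hvec P + t *\<^sub>R hvec Q}"

definition hyp_collinear :: "hyp_plane set \<Rightarrow> bool" where
  "hyp_collinear S \<longleftrightarrow> (\<exists>P Q. P \<noteq> Q \<and> S \<subseteq> hyp_line P Q)"

definition nondegenerate_triangle :: "hyp_plane \<Rightarrow> hyp_plane \<Rightarrow> hyp_plane \<Rightarrow> bool" where
  "nondegenerate_triangle A B C \<longleftrightarrow> \<not> hyp_collinear {A, B, C}"

definition circumscribed_circle ::
    "hyp_plane \<Rightarrow> hyp_plane \<Rightarrow> hyp_plane \<Rightarrow> hyp_plane \<Rightarrow> real \<Rightarrow> bool" where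
  "circumscribed_circle A B C Z R \<longleftrightarrow> {A, B, C} \<subseteq> sphere Z R"

(* The circle touches the line PQ at a single point, which lies on the side [P, Q]. *)

definition tangent_to_side :: "hyp_plane \<Rightarrow> hyp_plane \<Rightarrow> hyp_plane \<Rightarrow> real \<Rightarrow> bool" where
  "tangent_to_side P Q Z r \<longleftrightarrow> (\<exists>T \<in> hyp_segment P Q. hyp_line P Q \<inter> sphere Z r = {T})"

(* Requiring the points of contact to lie on the sides themselves, not merely on their
   extensions, is what excludes the escribed circles. *)

definition inscribed_circle ::
    "hyp_plane \<Rightarrow> hyp_plane \<Rightarrow> hyp_plane \<Rightarrow> hyp_plane \<Rightarrow> real \<Rightarrow> bool" where
  "inscribed_circle A B C Z r \<longleftrightarrow>
    r > 0 \<and> tangent_to_side B C Z r \<and> tangent_to_side C A Z r \<and> tangent_to_side A B Z r"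

end

theory Submission
  imports Defs
begin

text \<open>
  Let \<open>T\<close> be the point of contact of the incircle with a side \<open>PQ\<close>. Since \<open>T\<close> is the only common
  point, \<open>IT\<close> is orthogonal to the side, so \<open>cosh IP = cosh r cosh TP\<close> and likewise for \<open>Q\<close>. Hence
  the two tangent lengths from each vertex agree, and they are \<open>s - a\<close>, \<open>s - b\<close>, \<open>s - c\<close> with
  \<open>s = (a + b + c) / 2\<close>. The Lorentz products of \<open>I\<close> with the vertices are now known, and because the
  vertices form a basis this gives
  \<open>2 sinh s I = cosh r (sinh a A + sinh b B + sinh c C)\<close>. Pairing with \<open>O\<close> yields
  \<open>cosh OI = cosh r cosh R (sinh a + sinh b + sinh c) / (2 sinh s)\<close>. Expressing
  \<open>\<langle>I, I\<rangle> = \<langle>O, O\<rangle> = -1\<close> through the side lengths gives the product \<open>tanh r tanh R\<close>, and what is left is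
  an identity between hyperbolic functions of \<open>a / 2\<close>, \<open>b / 2\<close>, \<open>c / 2\<close>.
\<close>

section \<open>The Lorentz form\<close>

lemma lorentz_add_left: "lorentz (x + y) z = lorentz x z + lorentz y z"
  by (simp add: lorentz_def algebra_simps)

lemma lorentz_add_right: "lorentz x (y + z) = lorentz x y + lorentz x z"
  by (simp add: lorentz_def algebra_simps)

lemma lorentz_diff_left: "lorentz (x - y) z = lorentz x z - lorentz y z"
  by (simp add: lorentz_def algebra_simps)

lemma lorentz_scaleR_left: "lorentz (k *\<^sub>R x) y = k * lorentz x y"
  by (simp add: lorentz_def algebra_simps)

lemma lorentz_scaleR_right: "lorentz x (k *\<^sub>R y) = k * lorentz x y"
  by (simp add: lorentz_def algebra_simps)

lemmas lorentz_linear = lorentz_add_left lorentz_add_right lorentz_diff_left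
  lorentz_scaleR_left lorentz_scaleR_right

text \<open>The form has determinant -1, so a Gram determinant is minus the square of the
  determinant of the three vectors.\<close>

lemma lorentz_gram_det_nonpos:
  "lorentz x x * (lorentz y y * lorentz z z - (lorentz y z)\<^sup>2)
    - lorentz x y * (lorentz x y * lorentz z z - lorentz y z * lorentz x z)
    + lorentz x z * (lorentz x y * lorentz y z - lorentz y y * lorentz x z) \<le> 0"
proof -
  have "lorentz x x * (lorentz y y * lorentz z z - (lorentz y z)\<^sup>2)
      - lorentz x y * (lorentz x y * lorentz z z - lorentz y z * lorentz x z)
      + lorentz x z * (lorentz x y * lorentz y z - lorentz y y * lorentz x z)
    = - (x $ 1 * (y $ 2 * z $ 3 - y $ 3 * z $ 2) - x $ 2 * (y $ 1 * z $ 3 - y $ 3 * z $ 1)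
      + x $ 3 * (y $ 1 * z $ 2 - y $ 2 * z $ 1))\<^sup>2"
    unfolding lorentz_def by algebra
  then show ?thesis
    by simp
qed

lemma lorentz_nondegenerate:
  assumes "\<And>y. lorentz x y = 0"
  shows "x = 0"
  using assms[of "axis 1 1"] assms[of "axis 2 1"] assms[of "axis 3 1"]
  by (simp add: lorentz_def axis_def vec_eq_iff forall_3)

text \<open>If \<open>x\<close> were on the lower sheet, \<open>- x\<close> would be a point of the
  plane, and its product with \<open>hvec P\<close> would be at most -1, hence negative as
  well.\<close>

lemma hvec_surj:
  assumes "lorentz x x = - 1" "lorentz (hvec P) x < 0"
  obtains X where "hvec X = x"
proof -
  have "x $ 3 > 0"
  proof (rule ccontr)
    assume "\<not> x $ 3 > 0"
    moreover have "(x $ 3)\<^sup>2 = 1 + (x $ 1)\<^sup>2 + (x $ 2)\<^sup>2"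
      using assms(1) by (simp add: lorentz_def power2_eq_square)
    ultimately have "x $ 3 \<noteq> 0" and "x $ 3 < 0"
      by (smt (verit) power_zero_numeral zero_le_power2)+
    moreover have "lorentz (- x) (- x) = - 1"
      using assms(1) by (simp add: lorentz_def)
    ultimately have "hvec (Abs_hyp_plane (- x)) = - x"
      by (intro Abs_hyp_plane_inverse) simp
    then have "lorentz (hvec P) (- x) \<le> - 1"
      using lorentz_hvec_le[of P "Abs_hyp_plane (- x)"] by simp
    then show False
      using assms(2) by (simp add: lorentz_def)
  qed
  then have "hvec (Abs_hyp_plane x) = x"
    using assms(1) by (intro Abs_hyp_plane_inverse) simp
  then show ?thesis
    by (rule that)
qed

lemma ex_other_hyp_plane: "\<exists>Q :: hyp_plane. Q \<noteq> P"
proof -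
  have "hvec (Abs_hyp_plane (vector [0, 0, 1])) = vector [0, 0, 1]"
    "hvec (Abs_hyp_plane (vector [1, 0, sqrt 2])) = vector [1, 0, sqrt 2]"
    by (intro Abs_hyp_plane_inverse; simp add: lorentz_def)+
  then have "hvec (Abs_hyp_plane (vector [0, 0, 1])) $ 1
      \<noteq> hvec (Abs_hyp_plane (vector [1, 0, sqrt 2])) $ 1"
    by simp
  then show ?thesis
    by metis
qed

section \<open>Points of contact and triangles\<close>

text \<open>For \<open>hvec T = s *\<^sub>R hvec P + t *\<^sub>R hvec Q\<close>, the sinh of
  \<open>dist P T\<close> and of \<open>dist T Q\<close> is \<open>t\<close>, respectively
  \<open>s\<close>, times that of \<open>dist P Q\<close>; nonnegative \<open>s\<close> and
  \<open>t\<close> settle the signs of the roots. The addition formula for cosh then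
  applies.\<close>

lemma dist_hyp_segment:
  assumes "T \<in> hyp_segment P Q"
  shows "dist P T + dist T Q = dist P Q"
proof -
  obtain s t where st: "s \<ge> 0" "t \<ge> 0" "hvec T = s *\<^sub>R hvec P + t *\<^sub>R hvec Q"
    using assms by (auto simp: hyp_segment_def)
  define x where "x = cosh (dist P Q)"
  have PQ: "lorentz (hvec P) (hvec Q) = - x" "lorentz (hvec Q) (hvec P) = - x"
    by (simp_all add: x_def cosh_dist_hyp_plane lorentz_commute)
  have cP: "cosh (dist P T) = s + t * x"
    by (simp add: cosh_dist_hyp_plane st lorentz_linear PQ lorentz_hvec_self)
  have cQ: "cosh (dist T Q) = s * x + t"
    by (simp add: cosh_dist_hyp_plane st lorentz_linear PQ lorentz_hvec_self)
  have "lorentz (hvec T) (hvec T) = - (s\<^sup>2 + t\<^sup>2 + 2 * s * t * x)"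
    unfolding st
    by (simp add: lorentz_linear PQ lorentz_hvec_self power2_eq_square algebra_simps)
  then have one: "s\<^sup>2 + t\<^sup>2 + 2 * s * t * x = 1"
    by (simp add: lorentz_hvec_self)
  have sx: "(sinh (dist P Q))\<^sup>2 = x\<^sup>2 - 1"
    by (simp add: x_def cosh_square_eq)
  have "(sinh (dist P T))\<^sup>2 = (t * sinh (dist P Q))\<^sup>2"
    unfolding power_mult_distrib sx sinh_square_eq[of "dist P T"] cP using one by algebra
  then have sP: "sinh (dist P T) = t * sinh (dist P Q)"
    using st by (simp add: power2_eq_iff_nonneg)
  have "(sinh (dist T Q))\<^sup>2 = (s * sinh (dist P Q))\<^sup>2"
    unfolding power_mult_distrib sx sinh_square_eq[of "dist T Q"] cQ using one by algebra
  then have sQ: "sinh (dist T Q) = s * sinh (dist P Q)"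
    using st by (simp add: power2_eq_iff_nonneg)
  have "cosh (dist P T + dist T Q) = cosh (dist P Q)"
    unfolding cosh_add cP cQ sP sQ x_def[symmetric] using one sx by algebra
  then show ?thesis
    by (metis add_nonneg_nonneg arcosh_cosh_real zero_le_dist)
qed

text \<open>If \<open>Z\<close> had a nonzero product with the tangent vector \<open>d\<close> of the line at \<open>T\<close>, the reflection
  of \<open>T\<close> in the foot of the perpendicular from \<open>Z\<close> would be a second common point.\<close>

lemma tangent_point_orthogonal:
  assumes T: "hyp_line P Q \<inter> sphere Z r = {T}" and "r > 0"
    and e: "e \<in> span {hvec P, hvec Q}"
  shows "lorentz (hvec Z) e = cosh r * lorentz (hvec T) e"
proof -
  have Tline: "hvec T \<in> span {hvec P, hvec Q}" and "dist Z T = r"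
    using T by (auto simp: hyp_line_def)
  then have ZT: "lorentz (hvec Z) (hvec T) = - cosh r" "lorentz (hvec T) (hvec Z) = - cosh r"
    using cosh_dist_hyp_plane[of Z T] by (simp_all add: lorentz_commute)
  have C: "cosh r > 1"
    using \<open>r > 0\<close> cosh_real_nonneg_less_iff[of 0 r] by simp
  \<comment> \<open>The component of \<open>e\<close> orthogonal to \<open>hvec T\<close>, whose
    norm is -1.\<close>
  define d where "d = e + lorentz (hvec T) e *\<^sub>R hvec T"
  define k q where "k = lorentz (hvec Z) d" and "q = lorentz d d"
  have Td: "lorentz (hvec T) d = 0" "lorentz d (hvec T) = 0"
    by (simp_all add: d_def lorentz_linear lorentz_hvec_self lorentz_commute[of e])
  \<comment> \<open>The Gram inequality shows that \<open>d\<close> is spacelike once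
    \<open>k\<close> is nonzero, and later that \<open>D\<close> is at least
    \<open>q\<close>.\<close>
  have kq: "k\<^sup>2 \<le> q * ((cosh r)\<^sup>2 - 1)"
    using lorentz_gram_det_nonpos[of "hvec T" "hvec Z" d]
    by (simp add: Td ZT lorentz_hvec_self k_def[symmetric] q_def[symmetric]
        power2_eq_square algebra_simps)
  have "k = 0"
  proof (rule ccontr)
    assume "k \<noteq> 0"
    then have "q * ((cosh r)\<^sup>2 - 1) > 0"
      using kq by (smt (verit) zero_less_power2)
    moreover have "(cosh r)\<^sup>2 - 1 > 0"
      using C by (simp add: power2_eq_square less_1_mult)
    ultimately have "q > 0"
      by (simp add: zero_less_mult_iff)
    define D where "D = q * (cosh r)\<^sup>2 - k\<^sup>2"
    have "D > 0"
      using kq \<open>q > 0\<close> by (simp add: D_def algebra_simps)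
    \<comment> \<open>Modulo its normal, \<open>hvec Z\<close> is
      \<open>cosh r *\<^sub>R hvec T + (k / q) *\<^sub>R d\<close>, of norm \<open>- D / q\<close>.
      Reflecting \<open>hvec T\<close> in this direction gives the coefficients \<open>f\<close> and
      \<open>g\<close>.\<close>
    define f g where "f = (q * (cosh r)\<^sup>2 + k\<^sup>2) / D" and "g = 2 * k * cosh r / D"
    have fD: "f * D = q * (cosh r)\<^sup>2 + k\<^sup>2" and gD: "g * D = 2 * k * cosh r"
      using \<open>D > 0\<close> by (simp_all add: f_def g_def)
    define x where "x = f *\<^sub>R hvec T + g *\<^sub>R d"
    have "lorentz x x = g\<^sup>2 * q - f\<^sup>2"
      by (simp add: x_def lorentz_linear Td lorentz_hvec_self q_def[symmetric] power2_eq_square)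
    moreover have "D\<^sup>2 * (g\<^sup>2 * q - f\<^sup>2) = - D\<^sup>2"
      using fD gD D_def by algebra
    ultimately have xx: "lorentz x x = - 1"
      using \<open>D > 0\<close> by (metis less_numeral_extra(3) mult.right_neutral mult_cancel_left
          mult_minus_right power_eq_0_iff)
    have "lorentz (hvec Z) x = g * k - f * cosh r"
      by (simp add: x_def lorentz_linear ZT k_def[symmetric])
    moreover have "D * (g * k - f * cosh r) = - D * cosh r"
      using fD gD D_def by algebra
    ultimately have Zx: "lorentz (hvec Z) x = - cosh r"
      using \<open>D > 0\<close> by (metis less_numeral_extra(3) minus_mult_commute mult_left_cancel)
    moreover obtain X where X: "hvec X = x"
      using hvec_surj[OF xx, of Z] Zx C by force
    ultimately have "cosh (dist Z X) = cosh r"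
      by (simp add: cosh_dist_hyp_plane)
    then have "dist Z X = r"
      using \<open>r > 0\<close> by (metis arcosh_cosh_real less_imp_le zero_le_dist)
    moreover have "x \<in> span {hvec P, hvec Q}"
      unfolding x_def d_def by (intro span_add span_scale Tline e)
    ultimately have "X \<in> hyp_line P Q \<inter> sphere Z r"
      by (simp add: hyp_line_def X)
    then have "x = hvec T"
      using T X by auto
    then have "lorentz x d = 0"
      by (simp add: Td)
    moreover have "lorentz x d = g * q"
      by (simp add: x_def lorentz_linear Td q_def)
    ultimately show False
      using \<open>k \<noteq> 0\<close> \<open>q > 0\<close> \<open>D > 0\<close> C by (simp add: g_def)
  qed
  then show ?thesis
    by (simp add: k_def d_def lorentz_linear ZT)
qed

text \<open>Taking \<open>e\<close> to be an endpoint in \<open>tangent_point_orthogonal\<close>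
  gives the hyperbolic Pythagorean theorem for the right triangle formed by \<open>Z\<close>, the
  point of contact and that endpoint.\<close>

lemma tangent_to_side_obtain:
  assumes "tangent_to_side P Q Z r" "r > 0"
  obtains p q where "p \<ge> 0" "q \<ge> 0" "p + q = dist P Q"
    "lorentz (hvec Z) (hvec P) = - (cosh r * cosh p)"
    "lorentz (hvec Z) (hvec Q) = - (cosh r * cosh q)"
proof -
  obtain T where T: "T \<in> hyp_segment P Q" "hyp_line P Q \<inter> sphere Z r = {T}"
    using assms(1) by (auto simp: tangent_to_side_def)
  show thesis
  proof (rule that)
    show "dist T P + dist T Q = dist P Q"
      using dist_hyp_segment[OF T(1)] by (simp add: dist_commute)
    show "lorentz (hvec Z) (hvec P) = - (cosh r * cosh (dist T P))"
      using tangent_point_orthogonal[OF T(2) assms(2), of "hvec P"]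
      by (simp add: cosh_dist_hyp_plane span_base)
    show "lorentz (hvec Z) (hvec Q) = - (cosh r * cosh (dist T Q))"
      using tangent_point_orthogonal[OF T(2) assms(2), of "hvec Q"]
      by (simp add: cosh_dist_hyp_plane span_base)
  qed simp_all
qed

lemma nondegenerate_triangle_rotate:
  "nondegenerate_triangle A B C \<Longrightarrow> nondegenerate_triangle B C A"
  by (simp add: nondegenerate_triangle_def insert_commute)

lemma nondegenerate_triangle_notin_span:
  assumes "nondegenerate_triangle A B C"
  shows "B \<noteq> C" "hvec A \<notin> span {hvec B, hvec C}"
proof -
  have *: "P = Q \<or> X \<notin> hyp_line P Q" if "{A, B, C} = {P, Q, X}" for P Q X
  proof (rule ccontr)
    assume "\<not> ?thesis"
    then have "P \<noteq> Q" "{A, B, C} \<subseteq> hyp_line P Q"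
      unfolding that by (auto simp: hyp_line_def span_base)
    then show False
      using assms by (auto simp: nondegenerate_triangle_def hyp_collinear_def)
  qed
  show "B \<noteq> C"
  proof
    assume "B = C"
    show False
    proof (cases "A = B")
      case True
      \<comment> \<open>A line needs two distinct points, so three coinciding vertices call for an
        auxiliary one.\<close>
      obtain Q where "Q \<noteq> A"
        using ex_other_hyp_plane by blast
      moreover have "{A, B, C} \<subseteq> hyp_line A Q"
        using True \<open>B = C\<close> by (simp add: hyp_line_def span_base)
      ultimately show False
        using assms unfolding nondegenerate_triangle_def hyp_collinear_def by metis
    next
      case False
      then show False
        using *[of A B B] \<open>B = C\<close> by (simp add: hyp_line_def span_base)
    qed
  qed
  then show "hvec A \<notin> span {hvec B, hvec C}"
    using *[of B C A] by (auto simp: hyp_line_def)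
qed

text \<open>The vertices form a basis and the form is nondegenerate. Vector identities can therefore
  be checked by pairing with the three vertices.\<close>

lemma nondegenerate_triangle_lorentz_eq_0:
  assumes "nondegenerate_triangle A B C"
    and "lorentz x (hvec A) = 0" "lorentz x (hvec B) = 0" "lorentz x (hvec C) = 0"
  shows "x = 0"
proof -
  note A = nondegenerate_triangle_notin_span[OF assms(1)]
  note B = nondegenerate_triangle_notin_span[OF nondegenerate_triangle_rotate[OF assms(1)]]
  have "hvec B \<noteq> hvec C"
    using A(1) by (simp add: hvec_inject)
  moreover have "hvec B \<notin> span {hvec C}"
    using B(2) span_mono[of "{hvec C}" "{hvec C, hvec A}"] by blast
  moreover have "hvec C \<noteq> 0"
    using hvec_3_pos[of C] by auto
  ultimately have "independent {hvec B, hvec C}"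
    by (simp add: independent_insert)
  moreover have "hvec A \<notin> {hvec B, hvec C}"
    using A(2) by (metis span_base)
  ultimately have ind: "independent {hvec A, hvec B, hvec C}"
    using A(2) by (simp add: independent_insert)
  have card: "card {hvec A, hvec B, hvec C} = 3"
    using \<open>hvec B \<noteq> hvec C\<close> \<open>hvec A \<notin> {hvec B, hvec C}\<close> by simp
  have "(UNIV :: (real ^ 3) set) \<subseteq> span {hvec A, hvec B, hvec C}"
    using card by (intro card_ge_dim_independent ind) (simp_all add: dim_UNIV)
  then have span: "y \<in> span {hvec A, hvec B, hvec C}" for y
    by blast
  have "lorentz x y = 0" for y
    using span[of y]
  proof (induction rule: span_induct_alt)
    case base
    then show ?case
      by (simp add: lorentz_def)
  next
    case (step k z y)
    then show ?case
      using assms(2-4) by (auto simp: lorentz_linear)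
  qed
  then show ?thesis
    by (rule lorentz_nondegenerate)
qed

text \<open>The first row of the adjugate of the Gram matrix gives the coefficients of a vector that is
  orthogonal to the vertices if the determinant vanishes.\<close>

lemma nondegenerate_triangle_gram_nz:
  assumes "nondegenerate_triangle A B C"
    and "x = cosh (dist B C)" "y = cosh (dist C A)" "z = cosh (dist A B)"
  shows "1 + 2 * x * y * z - x\<^sup>2 - y\<^sup>2 - z\<^sup>2 \<noteq> 0"
proof
  assume 0: "1 + 2 * x * y * z - x\<^sup>2 - y\<^sup>2 - z\<^sup>2 = 0"
  note A = nondegenerate_triangle_notin_span[OF assms(1)]
  have L: "lorentz (hvec A) (hvec B) = - z" "lorentz (hvec B) (hvec A) = - z"
    "lorentz (hvec B) (hvec C) = - x" "lorentz (hvec C) (hvec B) = - x"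
    "lorentz (hvec C) (hvec A) = - y" "lorentz (hvec A) (hvec C) = - y"
    by (simp_all add: assms(2-4) cosh_dist_hyp_plane lorentz_commute)
  have "(x\<^sup>2 - 1) *\<^sub>R hvec A - ((x * y - z) *\<^sub>R hvec B + (x * z - y) *\<^sub>R hvec C) = 0"
    using 0
    by (intro nondegenerate_triangle_lorentz_eq_0[OF assms(1)])
      (simp_all add: lorentz_linear L lorentz_hvec_self power2_eq_square algebra_simps)
  then have eq: "(x\<^sup>2 - 1) *\<^sub>R hvec A = (x * y - z) *\<^sub>R hvec B + (x * z - y) *\<^sub>R hvec C"
    by simp
  have "x > 1"
    using A(1) cosh_real_nonneg_less_iff[of 0 "dist B C"] by (simp add: assms(2))
  then have nz: "x\<^sup>2 - 1 \<noteq> 0"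
    by (simp add: power2_eq_1_iff)
  have "hvec A = inverse (x\<^sup>2 - 1) *\<^sub>R ((x * y - z) *\<^sub>R hvec B + (x * z - y) *\<^sub>R hvec C)"
    unfolding eq[symmetric] using nz by simp
  also have "\<dots> \<in> span {hvec B, hvec C}"
    by (intro span_scale span_add span_base) simp_all
  finally show False
    using A(2) by contradiction
qed

section \<open>Hyperbolic identities\<close>

text \<open>With \<open>s = x + y + z\<close> the left side is
  \<open>sinh (s - x) + sinh (s + x)\<close>.\<close>

lemma sinh_sum_tangent_lengths:
  fixes x y z :: real
  shows "sinh (y + z) + sinh (z + x) * cosh (x + y) + sinh (x + y) * cosh (z + x)
    = 2 * sinh (x + y + z) * cosh x"
proof -
  have "sinh ((x + y + z) + x) = sinh (z + x) * cosh (x + y) + sinh (x + y) * cosh (z + x)"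
    using sinh_add[of "z + x" "x + y"] by (simp add: algebra_simps)
  moreover have "sinh (y + z) = sinh ((x + y + z) - x)"
    by simp
  ultimately show ?thesis
    using sinh_add[of "x + y + z" x] sinh_diff[of "x + y + z" x] by linarith
qed

text \<open>Brings the Gram determinant of the vertices into the norm condition on the
  incentre.\<close>

lemma sinh_cosh_tangent_lengths_gram:
  fixes x y z :: real
  shows "2 * sinh (x + y + z)
      * (sinh (y + z) * cosh x + sinh (z + x) * cosh y + sinh (x + y) * cosh z)
    = 4 * (sinh (x + y + z))\<^sup>2
      - (1 + 2 * cosh (y + z) * cosh (z + x) * cosh (x + y)
        - (cosh (y + z))\<^sup>2 - (cosh (z + x))\<^sup>2 - (cosh (x + y))\<^sup>2)"
  unfolding sinh_add cosh_add
  using cosh_square_eq[of x] cosh_square_eq[of y] cosh_square_eq[of z] by algebra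

text \<open>For half sides, this isolates the product of sinh that also occurs in
  \<open>tanh r * tanh R\<close>.\<close>

lemma sinh_sum_half:
  fixes x y z :: real
  shows "sinh (2 * x) + sinh (2 * y) + sinh (2 * z)
    = 2 * (2 * cosh x * cosh y * cosh z - cosh (x + y + z)) * sinh (x + y + z)
      + 4 * cosh (x + y + z) * sinh x * sinh y * sinh z"
  unfolding sinh_add cosh_add sinh_double
  using cosh_square_eq[of x] cosh_square_eq[of y] cosh_square_eq[of z] by algebra

lemma cosh_minus_1: "cosh x - 1 = 2 * (sinh (x / 2))\<^sup>2" for x :: real
  using cosh_double[of "x / 2"] by (simp add: cosh_square_eq)

section \<open>The circumcentre and the incentre\<close>

lemma circumradius_gram:
  assumes "nondegenerate_triangle A B C"
    and "circumscribed_circle A B C Z R"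
    and "x = cosh (dist B C)" "y = cosh (dist C A)" "z = cosh (dist A B)"
  shows "(sinh R)\<^sup>2 * (1 + 2 * x * y * z - x\<^sup>2 - y\<^sup>2 - z\<^sup>2)
    = 2 * (cosh R)\<^sup>2 * (x - 1) * (y - 1) * (z - 1)"
proof -
  define D where "D = 1 + 2 * x * y * z - x\<^sup>2 - y\<^sup>2 - z\<^sup>2"
  have "D \<noteq> 0"
    unfolding D_def by (rule nondegenerate_triangle_gram_nz[OF assms(1,3-5)])
  have L: "lorentz (hvec A) (hvec B) = - z" "lorentz (hvec B) (hvec A) = - z"
    "lorentz (hvec B) (hvec C) = - x" "lorentz (hvec C) (hvec B) = - x"
    "lorentz (hvec C) (hvec A) = - y" "lorentz (hvec A) (hvec C) = - y"
    by (simp_all add: assms(3-5) cosh_dist_hyp_plane lorentz_commute)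
  have "dist Z A = R" "dist Z B = R" "dist Z C = R"
    using assms(2) by (simp_all add: circumscribed_circle_def)
  then have Z: "lorentz (hvec Z) (hvec A) = - cosh R" "lorentz (hvec Z) (hvec B) = - cosh R"
    "lorentz (hvec Z) (hvec C) = - cosh R"
    using cosh_dist_hyp_plane[of Z] by (metis minus_minus)+
  \<comment> \<open>Row sums of the adjugate of the matrix of cosh values: by Cramer's rule, the
    coordinates of the circumcentre up to the factor \<open>cosh R / D\<close>.\<close>
  define p q t where "p = 1 - x\<^sup>2 + x * y - z + x * z - y"
    and "q = 1 - y\<^sup>2 + x * y - z + y * z - x" and "t = 1 - z\<^sup>2 + x * z - y + y * z - x"
  have "D *\<^sub>R hvec Z - cosh R *\<^sub>R (p *\<^sub>R hvec A + q *\<^sub>R hvec B + t *\<^sub>R hvec C) = 0"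
    by (intro nondegenerate_triangle_lorentz_eq_0[OF assms(1)])
      (simp_all add: lorentz_linear L Z lorentz_hvec_self p_def q_def t_def D_def
        power2_eq_square algebra_simps)
  then have "lorentz (hvec Z) (D *\<^sub>R hvec Z)
      = lorentz (hvec Z) (cosh R *\<^sub>R (p *\<^sub>R hvec A + q *\<^sub>R hvec B + t *\<^sub>R hvec C))"
    by simp
  \<comment> \<open>The norm of \<open>hvec Z\<close> is -1. Subtracting \<open>p + q + t\<close>
    from \<open>D\<close> leaves \<open>2 * (x - 1) * (y - 1) * (z - 1)\<close>.\<close>
  then have "D = (cosh R)\<^sup>2 * (p + q + t)"
    by (simp add: lorentz_linear Z lorentz_hvec_self power2_eq_square algebra_simps)
  then show ?thesis
    unfolding sinh_square_eq D_def p_def q_def t_def by algebra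
qed

text \<open>The parameters \<open>x\<close>, \<open>y\<close>, \<open>z\<close> are the tangent lengths from \<open>A\<close>, \<open>B\<close>, \<open>C\<close>.\<close>

lemma incentre_coordinates:
  assumes nd: "nondegenerate_triangle A B C" and ins: "inscribed_circle A B C Z r"
  obtains x y z where "dist B C = y + z" "dist C A = z + x" "dist A B = x + y" "x + y + z > 0"
    "(2 * sinh (x + y + z)) *\<^sub>R hvec Z = cosh r *\<^sub>R
      (sinh (y + z) *\<^sub>R hvec A + sinh (z + x) *\<^sub>R hvec B + sinh (x + y) *\<^sub>R hvec C)"
    "2 * sinh (x + y + z) = (cosh r)\<^sup>2 *
      (sinh (y + z) * cosh x + sinh (z + x) * cosh y + sinh (x + y) * cosh z)"
proof -
  have r: "r > 0" and tan: "tangent_to_side B C Z r" "tangent_to_side C A Z r"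
    "tangent_to_side A B Z r"
    using ins by (simp_all add: inscribed_circle_def)
  obtain y z where yz: "y \<ge> 0" "z \<ge> 0" "y + z = dist B C"
    "lorentz (hvec Z) (hvec B) = - (cosh r * cosh y)"
    "lorentz (hvec Z) (hvec C) = - (cosh r * cosh z)"
    using tangent_to_side_obtain[OF tan(1) r] .
  obtain z' x where zx: "z' \<ge> 0" "x \<ge> 0" "z' + x = dist C A"
    "lorentz (hvec Z) (hvec C) = - (cosh r * cosh z')"
    "lorentz (hvec Z) (hvec A) = - (cosh r * cosh x)"
    using tangent_to_side_obtain[OF tan(2) r] .
  obtain x' y' where xy: "x' \<ge> 0" "y' \<ge> 0" "x' + y' = dist A B"
    "lorentz (hvec Z) (hvec A) = - (cosh r * cosh x')"
    "lorentz (hvec Z) (hvec B) = - (cosh r * cosh y')"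
    using tangent_to_side_obtain[OF tan(3) r] .
  have "cosh x' = cosh x" "cosh y' = cosh y" "cosh z' = cosh z"
    using yz zx xy by simp_all
  then have eq: "x' = x" "y' = y" "z' = z"
    using yz zx xy by (metis arcosh_cosh_real)+
  have sides: "dist B C = y + z" "dist C A = z + x" "dist A B = x + y"
    using yz zx xy eq by simp_all
  have "dist B C > 0"
    using nondegenerate_triangle_notin_span(1)[OF nd] by simp
  then have pos: "x + y + z > 0"
    using sides zx by linarith
  have L: "lorentz (hvec A) (hvec B) = - cosh (x + y)" "lorentz (hvec B) (hvec A) = - cosh (x + y)"
    "lorentz (hvec B) (hvec C) = - cosh (y + z)" "lorentz (hvec C) (hvec B) = - cosh (y + z)"
    "lorentz (hvec C) (hvec A) = - cosh (z + x)" "lorentz (hvec A) (hvec C) = - cosh (z + x)"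
    by (simp_all add: sides[symmetric] cosh_dist_hyp_plane lorentz_commute)
  have s: "y + z + x = x + y + z" "z + x + y = x + y + z"
    by simp_all
  have "(2 * sinh (x + y + z)) *\<^sub>R hvec Z - cosh r *\<^sub>R
      (sinh (y + z) *\<^sub>R hvec A + sinh (z + x) *\<^sub>R hvec B + sinh (x + y) *\<^sub>R hvec C) = 0"
    (is "?j = 0")
  proof (rule nondegenerate_triangle_lorentz_eq_0[OF nd])
    \<comment> \<open>Up to the factor \<open>cosh r\<close>, each pairing is
      \<open>sinh_sum_tangent_lengths\<close>, shifted cyclically so that the tangent length of the
      vertex in question stands under the cosh on the right.\<close>
    show "lorentz ?j (hvec A) = 0"
      using sinh_sum_tangent_lengths[of y z x]
      unfolding lorentz_linear L zx(5) lorentz_hvec_self by algebra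
    show "lorentz ?j (hvec B) = 0"
      using sinh_sum_tangent_lengths[of z x y]
      unfolding lorentz_linear L yz(4) lorentz_hvec_self s by algebra
    show "lorentz ?j (hvec C) = 0"
      using sinh_sum_tangent_lengths[of x y z]
      unfolding lorentz_linear L yz(5) lorentz_hvec_self s by algebra
  qed
  then have coord: "(2 * sinh (x + y + z)) *\<^sub>R hvec Z = cosh r *\<^sub>R
      (sinh (y + z) *\<^sub>R hvec A + sinh (z + x) *\<^sub>R hvec B + sinh (x + y) *\<^sub>R hvec C)"
    by simp
  then have "lorentz (hvec Z) ((2 * sinh (x + y + z)) *\<^sub>R hvec Z) = lorentz (hvec Z) (cosh r *\<^sub>R
      (sinh (y + z) *\<^sub>R hvec A + sinh (z + x) *\<^sub>R hvec B + sinh (x + y) *\<^sub>R hvec C))"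
    by simp
  then have "2 * sinh (x + y + z) = (cosh r)\<^sup>2 *
      (sinh (y + z) * cosh x + sinh (z + x) * cosh y + sinh (x + y) * cosh z)"
    unfolding lorentz_linear zx(5) yz(4,5) lorentz_hvec_self by algebra
  with sides pos coord show thesis
    by (rule that)
qed

theorem theorem4p11:
  fixes A B C cO cI :: hyp_plane and a b c r R :: real
  assumes "nondegenerate_triangle A B C"
    and "a = dist B C" and "b = dist C A" and "c = dist A B"
    and "circumscribed_circle A B C cO R"
    and "inscribed_circle A B C cI r"
  shows "cosh (dist cO cI) =
    2 * cosh (a / 2) * cosh (b / 2) * cosh (c / 2) * cosh r * cosh R
    - cosh ((a + b + c) / 2) * cosh (R - r)"
proof -
  obtain x y z where sides: "dist B C = y + z" "dist C A = z + x" "dist A B = x + y"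
    and pos: "x + y + z > 0"
    and I: "(2 * sinh (x + y + z)) *\<^sub>R hvec cI = cosh r *\<^sub>R
      (sinh (y + z) *\<^sub>R hvec A + sinh (z + x) *\<^sub>R hvec B + sinh (x + y) *\<^sub>R hvec C)"
    and II: "2 * sinh (x + y + z) = (cosh r)\<^sup>2 *
      (sinh (y + z) * cosh x + sinh (z + x) * cosh y + sinh (x + y) * cosh z)"
    using incentre_coordinates[OF assms(1,6)] .
  have abc: "a = y + z" "b = z + x" "c = x + y"
    using assms(2-4) sides by simp_all
  define s where "s = x + y + z"
  have s: "(a + b + c) / 2 = s" "a / 2 + b / 2 + c / 2 = s"
    by (simp_all add: s_def abc field_simps)
  \<comment> \<open>Minus the Gram determinant of the vertices, that is, the square of the
    determinant of their coordinate vectors.\<close>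
  define D where "D = 1 + 2 * cosh a * cosh b * cosh c - (cosh a)\<^sup>2 - (cosh b)\<^sup>2 - (cosh c)\<^sup>2"
  define H where "H = sinh (a / 2) * sinh (b / 2) * sinh (c / 2)"
  have "D \<noteq> 0"
    unfolding D_def using nondegenerate_triangle_gram_nz[OF assms(1)] assms(2-4) by simp
  have sh: "sinh s > 0"
    using pos by (simp add: s_def)
  have "dist cO A = R" "dist cO B = R" "dist cO C = R"
    using assms(5) by (simp_all add: circumscribed_circle_def)
  then have O: "lorentz (hvec cO) (hvec A) = - cosh R" "lorentz (hvec cO) (hvec B) = - cosh R"
    "lorentz (hvec cO) (hvec C) = - cosh R" and "R \<ge> 0"
    using cosh_dist_hyp_plane[of cO] by (metis minus_minus zero_le_dist)+
  have "r > 0"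
    using assms(6) by (simp add: inscribed_circle_def)
  have "lorentz (hvec cO) ((2 * sinh s) *\<^sub>R hvec cI) = lorentz (hvec cO) (cosh r *\<^sub>R
      (sinh a *\<^sub>R hvec A + sinh b *\<^sub>R hvec B + sinh c *\<^sub>R hvec C))"
    using I by (simp add: s_def abc)
  then have OI: "2 * sinh s * cosh (dist cO cI)
      = cosh r * cosh R * (sinh a + sinh b + sinh c)"
    unfolding lorentz_linear O cosh_dist_hyp_plane by algebra
  have "(2 * sinh s)\<^sup>2 = (cosh r)\<^sup>2 * (4 * (sinh s)\<^sup>2 - D)"
    unfolding s_def D_def abc sinh_cosh_tangent_lengths_gram[symmetric]
    using II by algebra
  then have rD: "4 * (sinh s)\<^sup>2 * (sinh r)\<^sup>2 = (cosh r)\<^sup>2 * D"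
    unfolding sinh_square_eq[of r] by algebra
  have "(sinh R)\<^sup>2 * D = 2 * (cosh R)\<^sup>2 * (cosh a - 1) * (cosh b - 1) * (cosh c - 1)"
    unfolding D_def using circumradius_gram[OF assms(1,5)] assms(2-4) by simp
  then have RD: "(sinh R)\<^sup>2 * D = 16 * (cosh R)\<^sup>2 * H\<^sup>2"
    unfolding cosh_minus_1 H_def by algebra
  \<comment> \<open>\<open>rD\<close> puts \<open>D\<close> into the numerator of the square of
    \<open>tanh r\<close>, \<open>RD\<close> into the denominator of that of \<open>tanh R\<close>.
    In the product it cancels, leaving \<open>tanh r * tanh R = 2 * H / sinh s\<close> after a root
    of nonnegative terms.\<close>
  have "D * (sinh s * sinh r * sinh R)\<^sup>2 = D * (2 * cosh r * cosh R * H)\<^sup>2"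
    using rD RD by algebra
  then have "(sinh s * sinh r * sinh R)\<^sup>2 = (2 * cosh r * cosh R * H)\<^sup>2"
    using \<open>D \<noteq> 0\<close> by simp
  moreover have "sinh s * sinh r * sinh R \<ge> 0" "2 * cosh r * cosh R * H \<ge> 0"
    using sh \<open>r > 0\<close> \<open>R \<ge> 0\<close> by (simp_all add: H_def assms(2-4))
  ultimately have rR: "sinh s * sinh r * sinh R = 2 * cosh r * cosh R * H"
    by (simp add: power2_eq_iff_nonneg)
  have "sinh a + sinh b + sinh c
      = 2 * (2 * cosh (a / 2) * cosh (b / 2) * cosh (c / 2) - cosh s) * sinh s + 4 * cosh s * H"
    using sinh_sum_half[of "a / 2" "b / 2" "c / 2"] by (simp add: s H_def)
  \<comment> \<open>By \<open>rR\<close>, the term with \<open>H\<close> supplies the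
    \<open>sinh R * sinh r\<close> part of \<open>cosh (R - r)\<close>.\<close>
  then have "2 * sinh s * cosh (dist cO cI) = 2 * sinh s *
      (2 * cosh (a / 2) * cosh (b / 2) * cosh (c / 2) * cosh r * cosh R - cosh s * cosh (R - r))"
    using OI rR unfolding cosh_diff by algebra
  then show ?thesis
    using sh by (simp add: s)
qed

end
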